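(* Let $b>0$, $0<y<1$, and $\mu\in\mathbb{C}$ with $\mathrm{Re}(\mu)>0$. Then the $\mu$th lower incomplete Riemann--Liouville fractional integral, $f\mapsto {}^{RL}_{0}D^{-\mu}[f;y]$, defines a bounded (linear) operator $${}^{RL}_{0}D^{-\mu}[\,\cdot\,;y]:L^1[0,yb]\to L^1[0,b].$$
   Context: For $b>0$, $0<y<1$, $\mathrm{Re}(\mu)>0$, the $\mu$th lower incomplete Riemann--Liouville fractional integral of a complex-valued function $f$ is the function of $x\in[0,b]$ given by $${}^{RL}_{0}D_x^{-\mu}[f(x);y]={}^{RL}_{0}I_x^{\mu}[f(x);y]=\frac{1}{\Gamma(\mu)}\int_0^{yx}(x-t)^{\mu-1}f(t)\,\mathrm{d}t .$$ It depends only on the values of $f$ on $[0,yb]$. $L^1[0,c]$ denotes the usual Lebesgue space of complex-valued functions on $[0,c]$. *)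

theory Defs
  imports "HOL-Analysis.Analysis"
begin

text \<open>
  The Lebesgue space of complex-valued functions on a set of reals is represented by the integrable
  functions themselves; its elements are these functions modulo equality almost everywhere.
  Values outside the set are irrelevant.
\<close>

definition L1 :: "real set \<Rightarrow> (real \<Rightarrow> complex) set" where
  "L1 S = {f. integrable (lebesgue_on S) f}"

definition L1_norm :: "real set \<Rightarrow> (real \<Rightarrow> complex) \<Rightarrow> real" where
  "L1_norm S f = (\<integral>x. norm (f x) \<partial>lebesgue_on S)"

definition L1_eq :: "real set \<Rightarrow> (real \<Rightarrow> complex) \<Rightarrow> (real \<Rightarrow> complex) \<Rightarrow> bool" where
  "L1_eq S f g \<longleftrightarrow> (AE x in lebesgue_on S. f x = g x)"

text \<open>
  A map on representatives induces a bounded complex-linear operator between the spaces of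
  almost-everywhere classes. The second conjunct says that the map descends to classes; the
  linearity laws are equations between classes, hence hold almost everywhere.
\<close>

definition L1_bounded_linear ::
    "real set \<Rightarrow> real set \<Rightarrow> ((real \<Rightarrow> complex) \<Rightarrow> (real \<Rightarrow> complex)) \<Rightarrow> bool" where
  "L1_bounded_linear S S' T \<longleftrightarrow>
     (\<forall>f\<in>L1 S. T f \<in> L1 S') \<and>
     (\<forall>f\<in>L1 S. \<forall>g\<in>L1 S. L1_eq S f g \<longrightarrow> L1_eq S' (T f) (T g)) \<and>
     (\<forall>f\<in>L1 S. \<forall>g\<in>L1 S. L1_eq S' (T (\<lambda>x. f x + g x)) (\<lambda>x. T f x + T g x)) \<and>
     (\<forall>a. \<forall>f\<in>L1 S. L1_eq S' (T (\<lambda>x. a * f x)) (\<lambda>x. a * T f x)) \<and>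
     (\<exists>K. \<forall>f\<in>L1 S. L1_norm S' (T f) \<le> K * L1_norm S f)"

definition RL_integrand :: "complex \<Rightarrow> (real \<Rightarrow> complex) \<Rightarrow> real \<Rightarrow> real \<Rightarrow> complex" where
  "RL_integrand \<mu> f x t = complex_of_real (x - t) powr (\<mu> - 1) * f t"

definition lower_RL_integral ::
    "complex \<Rightarrow> real \<Rightarrow> (real \<Rightarrow> complex) \<Rightarrow> real \<Rightarrow> complex" where
  "lower_RL_integral \<mu> y f x =
     1 / Gamma \<mu> * (\<integral>t. RL_integrand \<mu> f x t \<partial>lebesgue_on {0..y * x})"

end

theory Submission imports Defs begin

text \<open>
  The incompleteness keeps the kernel away from its singularity. For \<open>0 \<le> t \<le> y x\<close> the distance
  \<open>x - t\<close> lies in \<open>[(1 - y) x, x]\<close>, so the kernel \<open>(x - t) powr (\<mu> - 1)\<close> has modulus at most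
  \<open>C * x powr (Re \<mu> - 1)\<close>, where \<open>C\<close> depends only on \<open>y\<close> and \<open>\<mu>\<close>
  (lemma \<open>norm_RL_kernel_le\<close>). For each fixed \<open>x\<close> the integrand is therefore a bounded measurable
  function times \<open>f\<close>, hence integrable, and the integral has modulus at most
  \<open>C * x powr (Re \<mu> - 1)\<close> times the \<open>L1\<close> norm of \<open>f\<close> (lemma \<open>norm_lower_RL_integral_le\<close>).
  Because \<open>Re \<mu> > 0\<close>, this majorant is integrable over \<open>[0, b]\<close>, and integrating it in \<open>x\<close> gives
  the operator bound; no interchange of integrals is involved, in contrast with the complete
  fractional integral, whose kernel is unbounded for each \<open>x > 0\<close> when \<open>Re \<mu> < 1\<close>.

  Measurability of the image in \<open>x\<close> is that of an integral depending on a parameter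
  (lemma \<open>borel_measurable_lower_RL_integral\<close>). Linearity holds at each point \<open>x\<close>, since all the
  integrals converge, and the operator respects equality almost everywhere because the integral at
  each \<open>x\<close> does.
\<close>

section \<open>The kernel\<close>

text \<open>
  The exponent \<open>Re \<mu> - 1\<close> may have either sign: a power of \<open>x - t\<close> is largest at
  the endpoint \<open>x\<close> of \<open>[(1 - y) x, x]\<close> if the exponent is nonnegative and at the endpoint
  \<open>(1 - y) x\<close> otherwise, whence the maximum. At \<open>x = 0\<close> both sides vanish since \<open>0 powr a = 0\<close>.
\<close>

lemma norm_RL_kernel_le:
  fixes x y t :: real and \<mu> :: complex
  assumes "y < 1" "0 \<le> x" "0 \<le> t" "t \<le> y * x"
  shows "norm (complex_of_real (x - t) powr (\<mu> - 1))
           \<le> max 1 ((1 - y) powr (Re \<mu> - 1)) * x powr (Re \<mu> - 1)"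
proof (cases "x = 0")
  case True
  then show ?thesis using assms by simp
next
  case False
  then have x: "x > 0" using assms by simp
  have low: "(1 - y) * x \<le> x - t" using assms by (simp add: algebra_simps)
  have pos: "0 < (1 - y) * x" using x assms by simp
  have "norm (complex_of_real (x - t) powr (\<mu> - 1)) = (x - t) powr (Re \<mu> - 1)"
    using low pos by (subst norm_powr_real_powr) auto
  also have "\<dots> \<le> max 1 ((1 - y) powr (Re \<mu> - 1)) * x powr (Re \<mu> - 1)"
  proof (cases "Re \<mu> \<ge> 1")
    case True
    then have "(x - t) powr (Re \<mu> - 1) \<le> 1 * x powr (Re \<mu> - 1)"
      using low pos assms by (simp add: powr_mono2)
    also have "\<dots> \<le> max 1 ((1 - y) powr (Re \<mu> - 1)) * x powr (Re \<mu> - 1)"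
      by (intro mult_right_mono) auto
    finally show ?thesis .
  next
    case False
    then have "(x - t) powr (Re \<mu> - 1) \<le> ((1 - y) * x) powr (Re \<mu> - 1)"
      using low pos by (intro powr_mono2') auto
    also have "\<dots> = (1 - y) powr (Re \<mu> - 1) * x powr (Re \<mu> - 1)"
      using x assms by (simp add: powr_mult)
    also have "\<dots> \<le> max 1 ((1 - y) powr (Re \<mu> - 1)) * x powr (Re \<mu> - 1)"
      by (intro mult_right_mono) auto
    finally show ?thesis .
  qed
  finally show ?thesis .
qed

text \<open>
  Cutting the power off on the negative axis avoids the branch cut of the complex logarithm; only
  nonnegative bases \<open>x - t\<close> occur below.
\<close>

lemma borel_measurable_powr_positive_part:
  "(\<lambda>u. if 0 < u then complex_of_real u powr a else 0) \<in> borel_measurable borel"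
proof -
  have "(\<lambda>u. if 0 < u then complex_of_real u powr a else 0) =
        (\<lambda>u. if 0 < u then exp (a * complex_of_real (ln u)) else 0)"
    by (auto simp: fun_eq_iff powr_def Ln_of_real)
  also have "\<dots> \<in> borel_measurable borel"
    by measurable
  finally show ?thesis .
qed

lemma powr_positive_part:
  "0 \<le> u \<Longrightarrow> (if 0 < u then complex_of_real u powr a else 0) = complex_of_real u powr a"
  by auto

section \<open>The integral at a fixed point\<close>

lemma borel_measurable_imp_lebesgue_on:
  "g \<in> borel_measurable borel \<Longrightarrow> g \<in> borel_measurable (lebesgue_on S)"
  by (simp add: measurable_completion measurable_restrict_space1)

lemma integrable_lebesgue_on_subinterval:
  fixes f :: "real \<Rightarrow> complex"
  assumes "integrable (lebesgue_on {0..c}) f" "d \<le> c"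
  shows "integrable (lebesgue_on {0..d}) f"
proof -
  have "integrable lebesgue (\<lambda>t. indicator {0..d} t *\<^sub>R (indicator {0..c} t *\<^sub>R f t))"
    by (rule integrable_mult_indicator)
       (use assms(1) in \<open>simp_all add: integrable_restrict_space\<close>)
  also have "(\<lambda>t. indicator {0..d} t *\<^sub>R (indicator {0..c} t *\<^sub>R f t)) =
             (\<lambda>t. indicator {0..d} t *\<^sub>R f t)"
    using assms by (auto simp: indicator_def)
  finally show ?thesis
    by (simp add: integrable_restrict_space)
qed

lemma norm_RL_integrand_le:
  assumes "y < 1" "0 \<le> x" "t \<in> {0..y * x}"
  shows "norm (RL_integrand \<mu> f x t)
           \<le> max 1 ((1 - y) powr (Re \<mu> - 1)) * x powr (Re \<mu> - 1) * norm (f t)"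
  using norm_RL_kernel_le[of y x t \<mu>] assms
  by (auto simp: RL_integrand_def norm_mult intro!: mult_right_mono)

lemma integrable_RL_integrand:
  assumes y: "y < 1" and x: "0 \<le> x" "y * x \<le> c" and f: "f \<in> L1 {0..c}"
  shows "integrable (lebesgue_on {0..y * x}) (RL_integrand \<mu> f x)"
proof -
  let ?C = "max 1 ((1 - y) powr (Re \<mu> - 1)) * x powr (Re \<mu> - 1)"
  have fint: "integrable (lebesgue_on {0..y * x}) f"
    using f x by (auto simp: L1_def intro: integrable_lebesgue_on_subinterval)
  have le: "t \<le> x" if "0 \<le> t" "t \<le> y * x" for t
    using that y x mult_right_mono[of y 1 x] by linarith
  have "(\<lambda>u. if 0 < u then complex_of_real u powr (\<mu> - 1) else 0) \<circ> (\<lambda>t. x - t)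
          \<in> borel_measurable borel"
    by (rule measurable_comp[OF _ borel_measurable_powr_positive_part]) measurable
  then have "(\<lambda>t. (if 0 < x - t then complex_of_real (x - t) powr (\<mu> - 1) else 0) * f t)
          \<in> borel_measurable (lebesgue_on {0..y * x})"
    using borel_measurable_imp_lebesgue_on fint
    by (intro borel_measurable_times) (auto simp: o_def)
  then have meas: "RL_integrand \<mu> f x \<in> borel_measurable (lebesgue_on {0..y * x})"
    by (rule measurable_lebesgue_cong[THEN iffD1, rotated])
       (auto simp: RL_integrand_def powr_positive_part dest: le)
  show ?thesis
  proof (rule Bochner_Integration.integrable_bound[OF _ meas])
    show "integrable (lebesgue_on {0..y * x}) (\<lambda>t. ?C * norm (f t))"
      using fint by auto
    show "AE t in lebesgue_on {0..y * x}. norm (RL_integrand \<mu> f x t) \<le> norm (?C * norm (f t))"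
      using norm_RL_integrand_le[OF y x(1), of _ \<mu> f] by (intro AE_I2) (auto simp: abs_mult)
  qed
qed

lemma norm_lower_RL_integral_le:
  assumes y: "y < 1" and x: "0 \<le> x" "y * x \<le> c" and f: "f \<in> L1 {0..c}"
  shows "norm (lower_RL_integral \<mu> y f x)
           \<le> norm (1 / Gamma \<mu>) * max 1 ((1 - y) powr (Re \<mu> - 1)) * L1_norm {0..c} f
               * x powr (Re \<mu> - 1)"
proof -
  let ?C = "max 1 ((1 - y) powr (Re \<mu> - 1)) * x powr (Re \<mu> - 1)"
  have fint: "integrable (lebesgue_on {0..c}) f"
    using f by (simp add: L1_def)
  have "norm (\<integral>t. RL_integrand \<mu> f x t \<partial>lebesgue_on {0..y * x})
          \<le> (\<integral>t. norm (RL_integrand \<mu> f x t) \<partial>lebesgue_on {0..y * x})"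
    by (rule integral_norm_bound)
  also have "\<dots> \<le> (\<integral>t. ?C * norm (f t) \<partial>lebesgue_on {0..c})"
    using fint x norm_RL_integrand_le[OF y x(1), of _ \<mu> f]
    by (intro integral_mono_lebesgue_on_AE AE_I2) auto
  also have "\<dots> = ?C * L1_norm {0..c} f"
    by (simp add: L1_norm_def)
  finally have "norm (1 / Gamma \<mu>) * norm (\<integral>t. RL_integrand \<mu> f x t \<partial>lebesgue_on {0..y * x})
      \<le> norm (1 / Gamma \<mu>) * (?C * L1_norm {0..c} f)"
    by (rule mult_left_mono) simp
  then show ?thesis
    unfolding lower_RL_integral_def norm_mult by (simp only: mult_ac)
qed

lemma lower_RL_integral_cong:
  assumes y: "y < 1" and x: "0 \<le> x" "y * x \<le> c"
    and f: "f \<in> L1 {0..c}" and g: "g \<in> L1 {0..c}" and eq: "L1_eq {0..c} f g"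
  shows "lower_RL_integral \<mu> y f x = lower_RL_integral \<mu> y g x"
proof -
  have "AE t in lebesgue. t \<in> {0..c} \<longrightarrow> f t = g t"
    using eq by (simp add: L1_eq_def AE_restrict_space_iff)
  then have "AE t in lebesgue_on {0..y * x}. RL_integrand \<mu> f x t = RL_integrand \<mu> g x t"
    using x by (auto simp: AE_restrict_space_iff RL_integrand_def)
  then have "(\<integral>t. RL_integrand \<mu> f x t \<partial>lebesgue_on {0..y * x})
           = (\<integral>t. RL_integrand \<mu> g x t \<partial>lebesgue_on {0..y * x})"
    using integrable_RL_integrand[OF y x f, of \<mu>] integrable_RL_integrand[OF y x g, of \<mu>]
    by (intro integral_cong_AE) auto
  then show ?thesis
    by (simp add: lower_RL_integral_def)
qed

lemma lower_RL_integral_add: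
  assumes "y < 1" "0 \<le> x" "y * x \<le> c" "f \<in> L1 {0..c}" "g \<in> L1 {0..c}"
  shows "lower_RL_integral \<mu> y (\<lambda>t. f t + g t) x
           = lower_RL_integral \<mu> y f x + lower_RL_integral \<mu> y g x"
proof -
  have "RL_integrand \<mu> (\<lambda>t. f t + g t) x = (\<lambda>t. RL_integrand \<mu> f x t + RL_integrand \<mu> g x t)"
    by (simp add: RL_integrand_def fun_eq_iff algebra_simps)
  then show ?thesis
    using integrable_RL_integrand[of y x c f \<mu>] integrable_RL_integrand[of y x c g \<mu>] assms
    by (simp add: lower_RL_integral_def distrib_left add_divide_distrib)
qed

lemma lower_RL_integral_mult:
  "lower_RL_integral \<mu> y (\<lambda>t. a * f t) x = a * lower_RL_integral \<mu> y f x"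
proof -
  have "RL_integrand \<mu> (\<lambda>t. a * f t) x = (\<lambda>t. a * RL_integrand \<mu> f x t)"
    by (simp add: RL_integrand_def fun_eq_iff)
  then show ?thesis
    by (simp add: lower_RL_integral_def)
qed

section \<open>Measurability in the outer variable\<close>

text \<open>
  Extended by zero, the integrand is a jointly measurable function of \<open>x\<close> and \<open>t\<close> on a domain of
  \<open>t\<close> that does not depend on \<open>x\<close>. Taking the Borel sets in \<open>x\<close> and the Lebesgue sets in
  \<open>t\<close> lets \<open>f\<close>, which is only Lebesgue measurable, enter through the second projection.
\<close>

lemma borel_measurable_lower_RL_integral:
  assumes y: "0 < y" "y < 1" and f: "f \<in> L1 {0..y * b}"
  shows "lower_RL_integral \<mu> y f \<in> borel_measurable (lebesgue_on {0..b})"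
proof -
  let ?M = "lebesgue_on {0..y * b}"
  define k where "k = (\<lambda>u. if 0 < u then complex_of_real u powr (\<mu> - 1) else 0)"
  have k [measurable]: "k \<in> borel_measurable borel"
    unfolding k_def by (rule borel_measurable_powr_positive_part)
  have f' [measurable]: "f \<in> borel_measurable ?M"
    using f by (auto simp: L1_def)
  have [measurable]: "(\<lambda>t. t) \<in> borel_measurable ?M"
    by (rule borel_measurable_imp_lebesgue_on) simp
  interpret finite_measure ?M
    by (rule finite_measure_lebesgue_on) simp
  have "(\<lambda>(x, t). if t \<le> y * x then k (x - t) * f t else 0) \<in> borel_measurable (borel \<Otimes>\<^sub>M ?M)"
    by measurable
  then have "(\<lambda>x. \<integral>t. (if t \<le> y * x then k (x - t) * f t else 0) \<partial>?M) \<in> borel_measurable borel"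
    by (rule borel_measurable_lebesgue_integral)
  then have "(\<lambda>x. 1 / Gamma \<mu> * (\<integral>t. (if t \<le> y * x then k (x - t) * f t else 0) \<partial>?M))
      \<in> borel_measurable (lebesgue_on {0..b})"
    by (intro borel_measurable_times borel_measurable_const borel_measurable_imp_lebesgue_on)
  then show ?thesis
  proof (rule measurable_lebesgue_cong[THEN iffD1, rotated])
    fix x assume x: "x \<in> {0..b}"
    have le: "t \<le> x" if "t \<le> y * x" for t
      using that y x mult_right_mono[of y 1 x] by auto
    have sub: "{0..y * x} \<subseteq> {0..y * b}"
      using x y by auto
    have "(\<integral>t. RL_integrand \<mu> f x t \<partial>lebesgue_on {0..y * x})
        = (\<integral>t. (if t \<in> {0..y * x} then RL_integrand \<mu> f x t else 0) \<partial>?M)"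
      using sub by (intro integral_restrict[symmetric]) auto
    also have "\<dots> = (\<integral>t. (if t \<le> y * x then k (x - t) * f t else 0) \<partial>?M)"
      by (intro Bochner_Integration.integral_cong)
         (auto simp: RL_integrand_def k_def powr_positive_part dest: le)
    finally show "1 / Gamma \<mu> * (\<integral>t. (if t \<le> y * x then k (x - t) * f t else 0) \<partial>?M)
        = lower_RL_integral \<mu> y f x"
      by (simp add: lower_RL_integral_def)
  qed
qed

section \<open>Boundedness\<close>

lemma integrable_powr_lebesgue_on:
  fixes a b :: real
  assumes "a > -1" "b \<ge> 0"
  shows "integrable (lebesgue_on {0..b}) (\<lambda>x. x powr a)"
proof (rule absolutely_integrable_imp_integrable)
  show "(\<lambda>x. x powr a) absolutely_integrable_on {0..b}"
    using has_integral_powr_from_0[OF assms]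
    by (intro nonnegative_absolutely_integrable_1) (auto simp: integrable_on_def)
qed simp

theorem theorem2p1:
  fixes b y :: real and \<mu> :: complex
  assumes "b > 0" and "0 < y" and "y < 1" and "Re \<mu> > 0"
  shows "(\<forall>f\<in>L1 {0..y * b}. \<forall>x\<in>{0..b}.
            integrable (lebesgue_on {0..y * x}) (RL_integrand \<mu> f x)) \<and>
         L1_bounded_linear {0..y * b} {0..b} (lower_RL_integral \<mu> y)"
proof -
  let ?A = "norm (1 / Gamma \<mu>) * max 1 ((1 - y) powr (Re \<mu> - 1))"
  let ?T = "lower_RL_integral \<mu> y"
  have yx: "y * x \<le> y * b" if "x \<in> {0..b}" for x
    using that assms by simp
  have maj: "integrable (lebesgue_on {0..b}) (\<lambda>x. ?A * N * x powr (Re \<mu> - 1))" for N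
    using integrable_powr_lebesgue_on[of "Re \<mu> - 1" b] assms by simp
  have bound: "norm (?T f x) \<le> ?A * L1_norm {0..y * b} f * x powr (Re \<mu> - 1)"
    if "f \<in> L1 {0..y * b}" "x \<in> {0..b}" for f x
    using norm_lower_RL_integral_le[of y x "y * b" f \<mu>] that yx assms by auto
  have int: "integrable (lebesgue_on {0..b}) (?T f)" if f: "f \<in> L1 {0..y * b}" for f
  proof (rule Bochner_Integration.integrable_bound[OF maj])
    show "?T f \<in> borel_measurable (lebesgue_on {0..b})"
      using borel_measurable_lower_RL_integral f assms by blast
    show "AE x in lebesgue_on {0..b}.
        norm (?T f x) \<le> norm (?A * L1_norm {0..y * b} f * x powr (Re \<mu> - 1))"
      using bound[OF f] by (intro AE_I2) (auto intro: order_trans[OF _ abs_ge_self])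
  qed
  have norm_le: "L1_norm {0..b} (?T f)
      \<le> (?A * (\<integral>x. x powr (Re \<mu> - 1) \<partial>lebesgue_on {0..b})) * L1_norm {0..y * b} f"
    if f: "f \<in> L1 {0..y * b}" for f
  proof -
    have "L1_norm {0..b} (?T f)
        \<le> (\<integral>x. ?A * L1_norm {0..y * b} f * x powr (Re \<mu> - 1) \<partial>lebesgue_on {0..b})"
      unfolding L1_norm_def[of "{0..b}"]
      using bound[OF f] int[OF f] by (intro integral_mono maj) auto
    then show ?thesis
      by (simp add: mult_ac)
  qed
  have "L1_bounded_linear {0..y * b} {0..b} ?T"
    unfolding L1_bounded_linear_def
  proof (intro conjI ballI allI impI exI)
    fix f assume "f \<in> L1 {0..y * b}"
    then show "?T f \<in> L1 {0..b}"
      using int by (simp add: L1_def)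
  next
    fix f g assume "f \<in> L1 {0..y * b}" "g \<in> L1 {0..y * b}" "L1_eq {0..y * b} f g"
    then show "L1_eq {0..b} (?T f) (?T g)"
      unfolding L1_eq_def[of "{0..b}"] using yx assms
      by (intro AE_I2 lower_RL_integral_cong[of _ _ "y * b"]) auto
  next
    fix f g assume "f \<in> L1 {0..y * b}" "g \<in> L1 {0..y * b}"
    then show "L1_eq {0..b} (?T (\<lambda>x. f x + g x)) (\<lambda>x. ?T f x + ?T g x)"
      unfolding L1_eq_def using yx assms
      by (intro AE_I2 lower_RL_integral_add[of _ _ "y * b"]) auto
  next
    fix a f
    show "L1_eq {0..b} (?T (\<lambda>x. a * f x)) (\<lambda>x. a * ?T f x)"
      by (simp add: L1_eq_def lower_RL_integral_mult)
  qed (rule norm_le)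
  moreover have "integrable (lebesgue_on {0..y * x}) (RL_integrand \<mu> f x)"
    if "f \<in> L1 {0..y * b}" "x \<in> {0..b}" for f x
    using integrable_RL_integrand[of y x "y * b" f \<mu>] that yx assms by auto
  ultimately show ?thesis
    by blast
qed

end
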